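(* Let $g_1(\nu),g_2(\nu)>0$ be the random normalized channel gains of two users, with a continuous joint probability density function, and let $0<\bar P\le\hat P$, $\bar R\ge0$. For a scheme $\mathrm{XX}\in\{\mathrm{NOMA},\mathrm{OMA\text{-}II}\}$ let $V_{\mathrm{XX}}$ be the optimal value (supremum, equal to $-\infty$ if infeasible) of $$\max\ \mathbb E_\nu[R_1^{\mathrm{XX}}(\nu)+R_2^{\mathrm{XX}}(\nu)]$$ over power allocations $p_1(\nu),p_2(\nu)$ (and, for OMA-II, resource fractions $\alpha_1(\nu),\alpha_2(\nu)\in[0,1]$ with $\alpha_1(\nu)+\alpha_2(\nu)=1$) depending on the fading state $\nu$, subject to $$\mathbb E_\nu[p_1(\nu)+p_2(\nu)]\le\bar P,\quad p_1(\nu)+p_2(\nu)\le\hat P\ \ \forall\nu,\quad p_1(\nu),p_2(\nu)\ge0\ \ \forall\nu,\quad \mathbb E_\nu[R_k^{\mathrm{XX}}(\nu)]\ge\bar R,\ k=1,2.$$ Then $V_{\mathrm{OMA\text{-}II}}\le V_{\mathrm{NOMA}}$.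
   Context: For $k\in\{1,2\}$ let $\bar k$ denote the other user. The instantaneous rates are $$R_k^{\mathrm{NOMA}}(\nu)=\begin{cases}\log_2(1+p_k(\nu)g_k(\nu)),& g_k(\nu)>g_{\bar k}(\nu),\\ \log_2\Big(1+\dfrac{p_k(\nu)g_k(\nu)}{p_{\bar k}(\nu)g_k(\nu)+1}\Big),&\text{otherwise,}\end{cases}\qquad R_k^{\mathrm{OMA\text{-}II}}(\nu)=\alpha_k(\nu)\log_2\Big(1+\frac{p_k(\nu)g_k(\nu)}{\alpha_k(\nu)}\Big),$$ with $R_k^{\mathrm{OMA\text{-}II}}(\nu)=0$ when $\alpha_k(\nu)=0$. All allocations are measurable functions of the fading state. In the paper $g_k=|h_k|^2/\sigma_k^2$ with $|h_k|^2$ exponentially distributed. *)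

theory Defs
  imports "HOL-Probability.Probability"
begin

text \<open>Expectation of a nonnegative random variable, with values in $[0,\infty]$. The
  ergodic rates may be infinite for a general gain density, and the Bochner integral would
  then return 0. The coercion to extended nonnegative reals maps negative reals to 0; this is
  inert here, since powers and rates of feasible allocations are nonnegative.\<close>

definition mean :: "'a measure \<Rightarrow> ('a \<Rightarrow> real) \<Rightarrow> ereal" where
  "mean M X = enn2ereal (\<integral>\<^sup>+\<nu>. ennreal (X \<nu>) \<partial>M)"

text \<open>In the rates, \<open>p\<close> and \<open>g\<close> are power and gain of the user under consideration,
  \<open>p'\<close> and \<open>g'\<close> those of the other user.\<close>

definition noma_rate :: "real \<Rightarrow> real \<Rightarrow> real \<Rightarrow> real \<Rightarrow> real" where
  "noma_rate g g' p p' =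
     (if g > g' then log 2 (1 + p * g) else log 2 (1 + p * g / (p' * g + 1)))"

definition oma2_rate :: "real \<Rightarrow> real \<Rightarrow> real \<Rightarrow> real" where
  "oma2_rate g a p = (if a = 0 then 0 else a * log 2 (1 + p * g / a))"

definition power_constraints ::
    "'a measure \<Rightarrow> real \<Rightarrow> real \<Rightarrow> ('a \<Rightarrow> real) \<Rightarrow> ('a \<Rightarrow> real) \<Rightarrow> bool" where
  "power_constraints M Pbar Phat p1 p2 \<longleftrightarrow>
     p1 \<in> borel_measurable M \<and> p2 \<in> borel_measurable M \<and>
     mean M (\<lambda>\<nu>. p1 \<nu> + p2 \<nu>) \<le> ereal Pbar \<and>
     (\<forall>\<nu>\<in>space M. p1 \<nu> + p2 \<nu> \<le> Phat) \<and>
     (\<forall>\<nu>\<in>space M. 0 \<le> p1 \<nu> \<and> 0 \<le> p2 \<nu>)"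

definition noma_feasible ::
    "'a measure \<Rightarrow> ('a \<Rightarrow> real) \<Rightarrow> ('a \<Rightarrow> real) \<Rightarrow> real \<Rightarrow> real \<Rightarrow> real \<Rightarrow>
     (('a \<Rightarrow> real) \<times> ('a \<Rightarrow> real)) set" where
  "noma_feasible M g1 g2 Pbar Phat Rbar = {(p1, p2).
     power_constraints M Pbar Phat p1 p2 \<and>
     mean M (\<lambda>\<nu>. noma_rate (g1 \<nu>) (g2 \<nu>) (p1 \<nu>) (p2 \<nu>)) \<ge> ereal Rbar \<and>
     mean M (\<lambda>\<nu>. noma_rate (g2 \<nu>) (g1 \<nu>) (p2 \<nu>) (p1 \<nu>)) \<ge> ereal Rbar}"

definition oma2_feasible ::
    "'a measure \<Rightarrow> ('a \<Rightarrow> real) \<Rightarrow> ('a \<Rightarrow> real) \<Rightarrow> real \<Rightarrow> real \<Rightarrow> real \<Rightarrow>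
     (('a \<Rightarrow> real) \<times> ('a \<Rightarrow> real) \<times> ('a \<Rightarrow> real) \<times> ('a \<Rightarrow> real)) set" where
  "oma2_feasible M g1 g2 Pbar Phat Rbar = {(p1, p2, a1, a2).
     power_constraints M Pbar Phat p1 p2 \<and>
     a1 \<in> borel_measurable M \<and> a2 \<in> borel_measurable M \<and>
     (\<forall>\<nu>\<in>space M. a1 \<nu> \<in> {0..1} \<and> a2 \<nu> \<in> {0..1} \<and> a1 \<nu> + a2 \<nu> = 1) \<and>
     mean M (\<lambda>\<nu>. oma2_rate (g1 \<nu>) (a1 \<nu>) (p1 \<nu>)) \<ge> ereal Rbar \<and>
     mean M (\<lambda>\<nu>. oma2_rate (g2 \<nu>) (a2 \<nu>) (p2 \<nu>)) \<ge> ereal Rbar}"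

text \<open>The supremum of the empty set of extended reals is $-\infty$, which is the value of an
  infeasible problem.\<close>

definition V_noma ::
    "'a measure \<Rightarrow> ('a \<Rightarrow> real) \<Rightarrow> ('a \<Rightarrow> real) \<Rightarrow> real \<Rightarrow> real \<Rightarrow> real \<Rightarrow> ereal" where
  "V_noma M g1 g2 Pbar Phat Rbar =
     (SUP (p1, p2) \<in> noma_feasible M g1 g2 Pbar Phat Rbar.
        mean M (\<lambda>\<nu>. noma_rate (g1 \<nu>) (g2 \<nu>) (p1 \<nu>) (p2 \<nu>)
                  + noma_rate (g2 \<nu>) (g1 \<nu>) (p2 \<nu>) (p1 \<nu>)))"

definition V_oma2 ::
    "'a measure \<Rightarrow> ('a \<Rightarrow> real) \<Rightarrow> ('a \<Rightarrow> real) \<Rightarrow> real \<Rightarrow> real \<Rightarrow> real \<Rightarrow> ereal" where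
  "V_oma2 M g1 g2 Pbar Phat Rbar =
     (SUP (p1, p2, a1, a2) \<in> oma2_feasible M g1 g2 Pbar Phat Rbar.
        mean M (\<lambda>\<nu>. oma2_rate (g1 \<nu>) (a1 \<nu>) (p1 \<nu>) + oma2_rate (g2 \<nu>) (a2 \<nu>) (p2 \<nu>)))"

end

theory Submission
  imports Defs
begin

text \<open>Almost surely the two gains differ, and in such a state superposition coding dominates
  time sharing for both users at the same total power. Give the stronger user, of gain \<open>g\<close>,
  the power \<open>q\<close> that reproduces its OMA-II rate, i.e.\ \<open>1 + q g = (1 + p g / a)\<^sup>a\<close>, and the
  weaker user, of gain \<open>g'\<close>, the rest. The map \<open>h \<mapsto> ((1 + p h / a)\<^sup>a - 1) / h\<close> is
  decreasing by concavity, so \<open>1 + q g' \<le> (1 + p g' / a)\<^sup>a\<close>, and the weighted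
  arithmetic-geometric mean inequality gives
  \<open>(1 + p g' / a)\<^sup>a (1 + p' g' / a')\<^bsup>a'\<^esup> \<le> 1 + (p + p') g'\<close>.\<close>

definition strong_power :: "real \<Rightarrow> real \<Rightarrow> real \<Rightarrow> real" where
  "strong_power g a p = ((1 + p * g / a) powr a - 1) / g"

text \<open>The tangent at 1 to the concave function \<open>z powr a\<close>, read off from the
  weighted arithmetic-geometric mean of \<open>z\<close> and 1.\<close>

lemma powr_le_Bernoulli:
  fixes z a :: real
  assumes "0 < z" "0 \<le> a" "a \<le> 1"
  shows "z powr a \<le> 1 + a * (z - 1)"
  using Youngs_inequality_0[of a "1 - a" z 1] assms by (simp add: algebra_simps)

lemma strong_power_nonneg:
  assumes "0 < g" "0 \<le> a" "0 \<le> p"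
  shows "0 \<le> strong_power g a p"
  using assms by (simp add: strong_power_def ge_one_powr_ge_zero)

text \<open>Ensures that the weaker user, who receives the rest of the total power, keeps at least
  its own OMA-II power.\<close>

lemma strong_power_le:
  assumes "0 < g" "0 \<le> a" "a \<le> 1" "0 \<le> p"
  shows "strong_power g a p \<le> p"
proof -
  have "0 < 1 + p * g / a"
    using assms by (simp add: add_pos_nonneg)
  then have "(1 + p * g / a) powr a \<le> 1 + a * (p * g / a)"
    using powr_le_Bernoulli[of "1 + p * g / a" a] assms by simp
  \<comment> \<open>An equality unless \<open>a = 0\<close>, where division by zero makes the left
    side 1.\<close>
  also have "\<dots> \<le> 1 + p * g"
    using assms by simp
  finally show ?thesis
    using assms by (simp add: strong_power_def field_simps)
qed

text \<open>Jensen's inequality for the power \<open>a\<close>: \<open>1 + p * g' / a\<close> is the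
  mean of 1 and \<open>1 + p * g / a\<close> with weights \<open>1 - g' / g\<close> and
  \<open>g' / g\<close>, and the left side is the same mean of their powers.\<close>

lemma strong_power_antimono:
  assumes "0 < g'" "g' \<le> g" "0 \<le> a" "a \<le> 1" "0 \<le> p"
  shows "1 + strong_power g a p * g' \<le> (1 + p * g' / a) powr a"
proof -
  define x where "x = p / a"
  define t where "t = g' / g"
  define m where "m = 1 + x * g'"
  define y where "y = 1 + x * g"
  have x: "0 \<le> x" using assms by (simp add: x_def)
  have t: "0 \<le> t" "t \<le> 1" using assms by (simp_all add: t_def)
  have m: "0 < m" using assms x by (simp add: m_def add_pos_nonneg)
  have y: "0 < y" using assms x by (simp add: y_def add_pos_nonneg)
  have mix: "(1 - t) + t * y = m"
    using assms by (simp add: t_def m_def y_def field_simps)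
  \<comment> \<open>Dividing by the mean \<open>m\<close> moves the point of tangency to 1; the
    linear terms then cancel in the average.\<close>
  have "(1 - t) * (1 / m) powr a + t * (y / m) powr a
      \<le> (1 - t) * (1 + a * (1 / m - 1)) + t * (1 + a * (y / m - 1))"
    using assms t m y by (intro add_mono mult_left_mono powr_le_Bernoulli) auto
  also have "\<dots> = 1 + a * (((1 - t) + t * y) / m - 1)"
    using m by (simp add: field_simps)
  also have "\<dots> = 1"
    using m by (simp only: mix) simp
  finally have "((1 - t) + t * y powr a) / m powr a \<le> 1"
    using m y by (simp add: powr_divide add_divide_distrib)
  then have "(1 - t) + t * y powr a \<le> m powr a"
    using m by (simp add: divide_le_eq)
  moreover have "1 + strong_power g a p * g' = (1 - t) + t * y powr a"
    using assms by (simp add: strong_power_def t_def y_def x_def field_simps)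
  ultimately show ?thesis
    by (simp add: m_def x_def)
qed

text \<open>The convention of rate 0 at \<open>a = 0\<close> fits this form: division by zero gives
  base 1, and \<open>1 powr 0 = 1\<close>.\<close>

lemma oma2_rate_eq_log_powr:
  assumes "0 < g" "0 \<le> a" "0 \<le> p"
  shows "oma2_rate g a p = log 2 ((1 + p * g / a) powr a)"
proof (cases "a = 0")
  case False
  have "0 < 1 + p * g / a"
    using assms by (simp add: add_pos_nonneg)
  with False show ?thesis by (simp add: oma2_rate_def log_powr)
qed (simp add: oma2_rate_def)

text \<open>\<open>strong_power\<close> is chosen to solve this equation. The stronger user sees no
  interference, so \<open>q'\<close> is arbitrary.\<close>

lemma oma2_rate_strong:
  assumes "0 < g" "g' < g" "0 \<le> a" "0 \<le> p"
  shows "oma2_rate g a p = noma_rate g g' (strong_power g a p) q'"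
  using assms by (simp add: oma2_rate_eq_log_powr noma_rate_def strong_power_def)

lemma oma2_rate_weak:
  assumes g: "0 < g'" "g' < g" and a: "0 \<le> a" "0 \<le> a'" "a + a' = 1"
    and p: "0 \<le> p" "0 \<le> p'"
  shows "oma2_rate g' a' p'
    \<le> noma_rate g' g (p + p' - strong_power g a p) (strong_power g a p)"
proof -
  define q where "q = strong_power g a p"
  define A where "A = 1 + p * g' / a"
  define B where "B = 1 + p' * g' / a'"
  have q: "0 \<le> q"
    using assms by (simp add: q_def strong_power_nonneg)
  have pos: "0 < A" "0 < B" "0 < 1 + q * g'"
    using assms q by (simp_all add: A_def B_def add_pos_nonneg)
  have "(1 + q * g') * B powr a' \<le> A powr a * B powr a'"
    using strong_power_antimono[of g' g a p] assms
    by (intro mult_right_mono) (simp_all add: q_def A_def)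
  also have "\<dots> \<le> a * A + a' * B"
    using Youngs_inequality_0[of a a' A B] a pos by simp
  also have "\<dots> \<le> 1 + (p + p') * g'"
  proof -
    have "a * A \<le> a + p * g'" "a' * B \<le> a' + p' * g'"
      using assms by (simp_all add: A_def B_def distrib_left)
    then show ?thesis using a by (simp add: algebra_simps)
  qed
  \<comment> \<open>Splits off the interference factor \<open>1 + q * g'\<close>, which then cancels
    and leaves the argument of the NOMA rate.\<close>
  also have "\<dots> = (1 + q * g') * (1 + (p + p' - q) * g' / (q * g' + 1))"
    using pos by (simp add: field_simps)
  finally have "B powr a' \<le> 1 + (p + p' - q) * g' / (q * g' + 1)"
    using pos by simp
  then have "log 2 (B powr a') \<le> log 2 (1 + (p + p' - q) * g' / (q * g' + 1))"
    using pos by (intro log_mono) auto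
  then show ?thesis
    using assms by (simp add: oma2_rate_eq_log_powr noma_rate_def q_def B_def)
qed

text \<open>By Fubini the diagonal is a Lebesgue null set, its sections being single points, and a
  law with a density inherits its null sets.\<close>

lemma AE_distributed_lborel_pair_neq:
  fixes X Y :: "'a \<Rightarrow> real" and f :: "real \<times> real \<Rightarrow> ennreal"
  assumes "distributed M (lborel \<Otimes>\<^sub>M lborel) (\<lambda>\<nu>. (X \<nu>, Y \<nu>)) f"
  shows "AE \<nu> in M. X \<nu> \<noteq> Y \<nu>"
proof -
  have "AE z in lborel \<Otimes>\<^sub>M lborel. fst z \<noteq> (snd z :: real)"
  proof (rule lborel_pair.AE_pair_measure)
    show "{z \<in> space (lborel \<Otimes>\<^sub>M lborel). fst z \<noteq> (snd z :: real)}
      \<in> sets (lborel \<Otimes>\<^sub>M lborel)"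
      by measurable
    have "AE y in lborel. x \<noteq> y" for x :: real
      using AE_lborel_singleton[of x] by eventually_elim auto
    then show "AE x in lborel. AE y in lborel. fst (x, y) \<noteq> (snd (x, y) :: real)"
      by simp
  qed
  then have "AE z in distr M (lborel \<Otimes>\<^sub>M lborel) (\<lambda>\<nu>. (X \<nu>, Y \<nu>)). fst z \<noteq> snd z"
    unfolding distributed_distr_eq_density[OF assms]
      AE_density[OF distributed_borel_measurable[OF assms]]
    by eventually_elim simp
  from AE_distrD[OF distributed_measurable[OF assms] this]
  show ?thesis by simp
qed

lemma mean_mono_AE:
  assumes "AE \<nu> in M. X \<nu> \<le> Y \<nu>"
  shows "mean M X \<le> mean M Y"
  unfolding mean_def less_eq_ennreal.rep_eq[symmetric]
  using assms by (intro nn_integral_mono_AE) (auto intro: ennreal_leI)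

theorem mainTheorem9:
  fixes M :: "'a measure" and g1 g2 :: "'a \<Rightarrow> real" and f :: "real \<times> real \<Rightarrow> real"
    and Pbar Phat Rbar :: real
  assumes "prob_space M"
    and "\<And>\<nu>. \<nu> \<in> space M \<Longrightarrow> g1 \<nu> > 0 \<and> g2 \<nu> > 0"
    and "distributed M (lborel \<Otimes>\<^sub>M lborel) (\<lambda>\<nu>. (g1 \<nu>, g2 \<nu>)) (\<lambda>x. ennreal (f x))"
    and "\<And>x. f x \<ge> 0"
    and "continuous_on ({0<..} \<times> {0<..}) f"
    and "0 < Pbar" and "Pbar \<le> Phat" and "0 \<le> Rbar"
  shows "V_oma2 M g1 g2 Pbar Phat Rbar \<le> V_noma M g1 g2 Pbar Phat Rbar"
  unfolding V_oma2_def
proof (rule SUP_least, clarify)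
  fix p1 p2 a1 a2
  assume "(p1, p2, a1, a2) \<in> oma2_feasible M g1 g2 Pbar Phat Rbar"
  then have pc: "power_constraints M Pbar Phat p1 p2"
    and [measurable]: "a1 \<in> borel_measurable M" "a2 \<in> borel_measurable M"
    and a: "\<And>\<nu>. \<nu> \<in> space M \<Longrightarrow>
      0 \<le> a1 \<nu> \<and> a1 \<nu> \<le> 1 \<and> 0 \<le> a2 \<nu> \<and> a2 \<nu> \<le> 1 \<and> a1 \<nu> + a2 \<nu> = 1"
    and rate1: "ereal Rbar \<le> mean M (\<lambda>\<nu>. oma2_rate (g1 \<nu>) (a1 \<nu>) (p1 \<nu>))"
    and rate2: "ereal Rbar \<le> mean M (\<lambda>\<nu>. oma2_rate (g2 \<nu>) (a2 \<nu>) (p2 \<nu>))"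
    by (auto simp: oma2_feasible_def)
  from pc have [measurable]: "p1 \<in> borel_measurable M" "p2 \<in> borel_measurable M"
    and p: "\<And>\<nu>. \<nu> \<in> space M \<Longrightarrow> 0 \<le> p1 \<nu> \<and> 0 \<le> p2 \<nu>"
    by (auto simp: power_constraints_def)
  have "(\<lambda>\<nu>. (g1 \<nu>, g2 \<nu>)) \<in> M \<rightarrow>\<^sub>M lborel \<Otimes>\<^sub>M lborel"
    using assms(3) by (simp add: distributed_def)
  from measurable_compose[OF this measurable_fst] measurable_compose[OF this measurable_snd]
  have [measurable]: "g1 \<in> borel_measurable M" "g2 \<in> borel_measurable M"
    by simp_all

  \<comment> \<open>The last case, equal gains, is a null event; \<open>p1\<close> is chosen there
    only to keep both powers nonnegative in every state.\<close>
  define q1 where "q1 \<nu> =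
    (if g2 \<nu> < g1 \<nu> then strong_power (g1 \<nu>) (a1 \<nu>) (p1 \<nu>)
     else if g1 \<nu> < g2 \<nu> then p2 \<nu> + p1 \<nu> - strong_power (g2 \<nu>) (a2 \<nu>) (p2 \<nu>)
     else p1 \<nu>)" for \<nu>
  \<comment> \<open>Preserving the total power in each state carries over both the mean and the peak
    constraint.\<close>
  define q2 where "q2 \<nu> = p1 \<nu> + p2 \<nu> - q1 \<nu>" for \<nu>
  have total: "q1 \<nu> + q2 \<nu> = p1 \<nu> + p2 \<nu>" for \<nu>
    by (simp add: q2_def)
  have q_nonneg: "0 \<le> q1 \<nu> \<and> 0 \<le> q2 \<nu>" if "\<nu> \<in> space M" for \<nu>
    using p[OF that] a[OF that] assms(2)[OF that]
      strong_power_nonneg[of "g1 \<nu>" "a1 \<nu>" "p1 \<nu>"] strong_power_le[of "g1 \<nu>" "a1 \<nu>" "p1 \<nu>"]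
      strong_power_nonneg[of "g2 \<nu>" "a2 \<nu>" "p2 \<nu>"] strong_power_le[of "g2 \<nu>" "a2 \<nu>" "p2 \<nu>"]
    by (auto simp: q1_def q2_def)
  have meas_q1 [measurable]: "q1 \<in> borel_measurable M"
    unfolding q1_def strong_power_def by measurable
  have "q2 \<in> borel_measurable M"
    unfolding q2_def by measurable
  with meas_q1 pc q_nonneg have pcq: "power_constraints M Pbar Phat q1 q2"
    by (auto simp: power_constraints_def total)

  have "oma2_rate (g1 \<nu>) (a1 \<nu>) (p1 \<nu>) \<le> noma_rate (g1 \<nu>) (g2 \<nu>) (q1 \<nu>) (q2 \<nu>) \<and>
      oma2_rate (g2 \<nu>) (a2 \<nu>) (p2 \<nu>) \<le> noma_rate (g2 \<nu>) (g1 \<nu>) (q2 \<nu>) (q1 \<nu>)"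
    if \<nu>: "\<nu> \<in> space M" and neq: "g1 \<nu> \<noteq> g2 \<nu>" for \<nu>
  proof (cases "g2 \<nu> < g1 \<nu>")
    case True
    then show ?thesis
      using p[OF \<nu>] a[OF \<nu>] assms(2)[OF \<nu>]
        oma2_rate_strong[of "g1 \<nu>" "g2 \<nu>" "a1 \<nu>" "p1 \<nu>" "q2 \<nu>"]
        oma2_rate_weak[of "g2 \<nu>" "g1 \<nu>" "a1 \<nu>" "a2 \<nu>" "p1 \<nu>" "p2 \<nu>"]
      by (auto simp: q1_def q2_def)
  next
    case False
    with neq have "g1 \<nu> < g2 \<nu>" by simp
    then show ?thesis
      using p[OF \<nu>] a[OF \<nu>] assms(2)[OF \<nu>]
        oma2_rate_strong[of "g2 \<nu>" "g1 \<nu>" "a2 \<nu>" "p2 \<nu>" "q1 \<nu>"]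
        oma2_rate_weak[of "g1 \<nu>" "g2 \<nu>" "a2 \<nu>" "a1 \<nu>" "p2 \<nu>" "p1 \<nu>"]
      by (auto simp: q1_def q2_def add.commute)
  qed
  then have dom:
    "AE \<nu> in M. oma2_rate (g1 \<nu>) (a1 \<nu>) (p1 \<nu>) \<le> noma_rate (g1 \<nu>) (g2 \<nu>) (q1 \<nu>) (q2 \<nu>) \<and>
      oma2_rate (g2 \<nu>) (a2 \<nu>) (p2 \<nu>) \<le> noma_rate (g2 \<nu>) (g1 \<nu>) (q2 \<nu>) (q1 \<nu>)"
    using AE_distributed_lborel_pair_neq[OF assms(3)] by fastforce
  \<comment> \<open>Domination of each user's rate, not only of the sum, is what preserves the two
    minimum-rate constraints.\<close>
  have "mean M (\<lambda>\<nu>. oma2_rate (g1 \<nu>) (a1 \<nu>) (p1 \<nu>))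
      \<le> mean M (\<lambda>\<nu>. noma_rate (g1 \<nu>) (g2 \<nu>) (q1 \<nu>) (q2 \<nu>))"
    "mean M (\<lambda>\<nu>. oma2_rate (g2 \<nu>) (a2 \<nu>) (p2 \<nu>))
      \<le> mean M (\<lambda>\<nu>. noma_rate (g2 \<nu>) (g1 \<nu>) (q2 \<nu>) (q1 \<nu>))"
    using dom by (auto intro!: mean_mono_AE)
  with pcq rate1 rate2 have "(q1, q2) \<in> noma_feasible M g1 g2 Pbar Phat Rbar"
    by (auto simp: noma_feasible_def)
  moreover have "mean M (\<lambda>\<nu>. oma2_rate (g1 \<nu>) (a1 \<nu>) (p1 \<nu>) + oma2_rate (g2 \<nu>) (a2 \<nu>) (p2 \<nu>))
      \<le> mean M (\<lambda>\<nu>. noma_rate (g1 \<nu>) (g2 \<nu>) (q1 \<nu>) (q2 \<nu>)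
                  + noma_rate (g2 \<nu>) (g1 \<nu>) (q2 \<nu>) (q1 \<nu>))"
    using dom by (intro mean_mono_AE) (auto intro: add_mono)
  ultimately show "mean M (\<lambda>\<nu>. oma2_rate (g1 \<nu>) (a1 \<nu>) (p1 \<nu>) + oma2_rate (g2 \<nu>) (a2 \<nu>) (p2 \<nu>))
      \<le> V_noma M g1 g2 Pbar Phat Rbar"
    unfolding V_noma_def by (intro SUP_upper2[of "(q1, q2)"]) auto
qed

end
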